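(* For integers $n\ge 3$, let $f_q(n)$ be the total number of occurrences of the pattern $q$ in all permutations of $S_n(123,132,213)$. Then, as formal power series in $x$, $$\sum_{n\geq 3}f_{231}(n)x^n=\sum_{n\geq 3}f_{312}(n)x^n=\frac{x^3(1+2x)}{(1-x-x^2)^3},$$ $$\sum_{n\geq 3}f_{321}(n)x^n=\frac{x^3(1+6x+12x^2+8x^3)}{(1-x-x^2)^4}.$$
   Context: $S_n$ is the set of permutations of $\{1,\dots,n\}$ written in one-line notation $\sigma=\sigma_1\sigma_2\cdots\sigma_n$. For $q\in S_k$, an occurrence of the pattern $q$ in $\sigma\in S_n$ is a choice of indices $i_1<i_2<\cdots<i_k$ in $\{1,\dots,n\}$ such that for all $1\le j,l\le k$, $q_j<q_l$ if and only if $\sigma_{i_j}<\sigma_{i_l}$. Let $f_q(\sigma)$ be the number of occurrences of $q$ in $\sigma$; $\sigma$ avoids $q$ if $f_q(\sigma)=0$. $S_n(123,132,213)$ is the set of permutations in $S_n$ avoiding all of $123$, $132$ and $213$, and $f_q(n)=\sum_{\sigma\in S_n(123,132,213)}f_q(\sigma)$. *)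

theory Defs
  imports
    "HOL-Combinatorics.Multiset_Permutations"
    "HOL-Computational_Algebra.Formal_Power_Series"
begin

text \<open>
  Permutations of \<open>{1..n}\<close> are given in one-line notation, as the lists in
  \<open>permutations_of_set {1..n}\<close>; patterns are lists of the same kind. List positions count
  from \<open>0\<close>, so \<open>\<sigma> ! i\<close> is the entry written \<open>\<sigma>\<close> with subscript \<open>i + 1\<close>.
  An occurrence is the strictly increasing list of the chosen positions.
\<close>

definition occurrences :: "nat list \<Rightarrow> nat list \<Rightarrow> nat list set" where
  "occurrences q \<sigma> = {ps. length ps = length q \<and> sorted_wrt (<) ps \<and> set ps \<subseteq> {..<length \<sigma>} \<and>
     (\<forall>j<length q. \<forall>l<length q. q ! j < q ! l \<longleftrightarrow> \<sigma> ! (ps ! j) < \<sigma> ! (ps ! l))}"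

lemma finite_occurrences: "finite (occurrences q \<sigma>)"
proof (rule finite_subset)
  show "occurrences q \<sigma> \<subseteq> {ps. set ps \<subseteq> {..<length \<sigma>} \<and> length ps = length q}"
    by (auto simp: occurrences_def)
  show "finite {ps. set ps \<subseteq> {..<length \<sigma>} \<and> length ps = length q}"
    by (rule finite_lists_length_eq) simp
qed

definition num_occurrences :: "nat list \<Rightarrow> nat list \<Rightarrow> nat" where
  "num_occurrences q \<sigma> = card (occurrences q \<sigma>)"

definition avoids :: "nat list \<Rightarrow> nat list \<Rightarrow> bool" where
  "avoids \<sigma> q \<longleftrightarrow> num_occurrences q \<sigma> = 0"

definition avoiders :: "nat \<Rightarrow> nat list set \<Rightarrow> nat list set" where
  "avoiders n Q = {\<sigma> \<in> permutations_of_set {1..n}. \<forall>q\<in>Q. avoids \<sigma> q}"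

definition total_occurrences :: "nat list \<Rightarrow> nat \<Rightarrow> nat" where
  "total_occurrences q n =
     (\<Sum>\<sigma>\<in>avoiders n {[1,2,3], [1,3,2], [2,1,3]}. num_occurrences q \<sigma>)"

definition occurrence_gf :: "nat list \<Rightarrow> rat fps" where
  "occurrence_gf q = Abs_fps (\<lambda>n. if n \<ge> 3 then of_nat (total_occurrences q n) else 0)"

end

theory Submission
  imports Defs "HOL-Library.Sublist"
begin

text \<open>
  A permutation of \<open>{1..n}\<close> avoiding 123, 132 and 213 starts either with \<open>n\<close> or with \<open>n - 1, n\<close>,
  and the remainder is an arbitrary avoider. Hence, for every statistic \<open>w\<close> whose value changes
  in a controlled way under these two prefixes, the generating function of \<open>w\<close> satisfies a linear
  equation with coefficient \<open>D = 1 - x - x\<^sup>2\<close>. Applied in turn to the constant 1, the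
  length, the patterns 12 and 21, and finally 231, 312 and 321, this yields all the series.
\<close>

section \<open>Counting subsequences\<close>

text \<open>Subsequences are taken from the list \<open>subseqs xs\<close>, so a list of values is
  counted once for each choice of positions, and a count over \<open>x # xs\<close> splits by
  whether \<open>x\<close> is chosen.\<close>

definition subseq_count :: "('a list \<Rightarrow> bool) \<Rightarrow> 'a list \<Rightarrow> nat" where
  "subseq_count P xs = length (filter P (subseqs xs))"

lemma subseq_count_Nil: "subseq_count P [] = of_bool (P [])"
  by (simp add: subseq_count_def)

lemma subseq_count_Cons:
  "subseq_count P (x # xs) = subseq_count (\<lambda>l. P (x # l)) xs + subseq_count P xs"
  by (simp add: subseq_count_def Let_def filter_map comp_def)

lemma subseq_count_cong:
  assumes "\<And>l. subseq l xs \<Longrightarrow> P l \<longleftrightarrow> Q l"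
  shows "subseq_count P xs = subseq_count Q xs"
  unfolding subseq_count_def using assms
  by (metis (mono_tags, lifting) filter_cong in_set_subseqs)

text \<open>This weaker form suffices for the patterns: there the only fact about the chosen entries
  is that they lie below a bound.\<close>

lemma subseq_count_cong_set:
  assumes "\<And>l. set l \<subseteq> set xs \<Longrightarrow> P l \<longleftrightarrow> Q l"
  shows "subseq_count P xs = subseq_count Q xs"
  by (rule subseq_count_cong, rule assms) (auto elim: list_emb_set)

lemma subseq_count_eq_0_iff:
  "subseq_count P xs = 0 \<longleftrightarrow> (\<forall>l. subseq l xs \<longrightarrow> \<not> P l)"
  by (auto simp: subseq_count_def filter_empty_conv)

lemma subseq_count_False [simp]: "subseq_count (\<lambda>_. False) xs = 0"
  by (simp add: subseq_count_def)

lemma subseq_count_empty: "subseq_count (\<lambda>l. l = []) xs = 1"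
  by (induction xs) (simp_all add: subseq_count_Nil subseq_count_Cons)

lemma subseq_count_singleton: "subseq_count (\<lambda>l. \<exists>a. l = [a]) xs = length xs"
  by (induction xs) (simp_all add: subseq_count_Nil subseq_count_Cons subseq_count_empty)

text \<open>Bridge from lists of positions to subsequences. A strictly increasing position list
  either starts with 0 or is the shift of a position list for the tail; this matches the recursion
  of \<open>subseq_count\<close>. \<open>P\<close> varies in the induction because choosing
  \<open>x\<close> changes the predicate, and finiteness is carried along for the cardinality of the
  union.\<close>

lemma card_positions_eq_subseq_count:
  fixes xs :: "'a list"
  defines "S \<equiv> \<lambda>P (xs :: 'a list).
    {ps. sorted_wrt (<) ps \<and> set ps \<subseteq> {..<length xs} \<and> P (map ((!) xs) ps)}"
  shows "finite (S P xs) \<and> card (S P xs) = subseq_count P xs"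
proof (induction xs arbitrary: P)
  case Nil
  have "S P [] = (if P [] then {[]} else {})"
    by (auto simp: S_def)
  then show ?case by (simp add: subseq_count_Nil)
next
  case (Cons x xs)
  define C where "C = (\<lambda>ps. 0 # map Suc ps) ` S (\<lambda>l. P (x # l)) xs"
  define R where "R = map Suc ` S P xs"
  \<comment> \<open>Subtraction on \<open>nat\<close> is truncated, so the shift back is an inverse
    only when 0 is absent.\<close>
  have map_Suc: "map Suc (map (\<lambda>p. p - 1) qs) = qs" if "0 \<notin> set qs" for qs
    using that by (induction qs) auto
  have "ps \<in> S P (x # xs) \<longleftrightarrow> ps \<in> C \<union> R" for ps
  proof (cases "0 \<in> set ps")
    case True
    show ?thesis
    proof (cases ps)
      case Nil
      with True show ?thesis by simp
    next
      case (Cons p qs)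
      have "ps \<in> C" if "ps \<in> S P (x # xs)"
      proof -
        \<comment> \<open>In a strictly increasing list, 0 can only stand at the head.\<close>
        have p: "p = 0" and qs: "0 \<notin> set qs"
          using that True Cons by (auto simp: S_def)
        define rs where "rs = map (\<lambda>p. p - 1) qs"
        have "qs = map Suc rs"
          using map_Suc[OF qs] by (simp add: rs_def)
        with that p Cons show ?thesis
          by (auto simp: S_def C_def sorted_wrt_map comp_def)
      qed
      moreover have "ps \<in> S P (x # xs)" if "ps \<in> C"
        using that by (auto simp: S_def C_def sorted_wrt_map comp_def)
      moreover have "ps \<notin> R"
        using True by (auto simp: R_def)
      ultimately show ?thesis by blast
    qed
  next
    case False
    define rs where "rs = map (\<lambda>p. p - 1) ps"
    have ps: "ps = map Suc rs"
      using map_Suc[OF False] by (simp add: rs_def)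
    have "ps \<in> R \<longleftrightarrow> rs \<in> S P xs"
      unfolding R_def ps by (simp add: inj_image_mem_iff)
    moreover have "ps \<notin> C"
      using False by (auto simp: C_def)
    moreover have "ps \<in> S P (x # xs) \<longleftrightarrow> rs \<in> S P xs"
      unfolding ps by (auto simp: S_def sorted_wrt_map comp_def)
    ultimately show ?thesis by blast
  qed
  then have eq: "S P (x # xs) = C \<union> R" by blast
  have "finite C" "finite R"
    unfolding C_def R_def using Cons.IH by blast+
  moreover have "C \<inter> R = {}"
    by (auto simp: C_def R_def)
  moreover have "card C = subseq_count (\<lambda>l. P (x # l)) xs"
    unfolding C_def using Cons.IH by (subst card_image) (auto simp: inj_on_def)
  moreover have "card R = subseq_count P xs"
    unfolding R_def using Cons.IH by (subst card_image) (auto simp: inj_on_def)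
  ultimately show ?case
    unfolding eq by (simp add: card_Un_disjoint subseq_count_Cons)
qed

section \<open>Pattern occurrences\<close>

text \<open>Detaches the comparison of values from the choice of positions, so that it can serve as
  the predicate of \<open>subseq_count\<close>.\<close>

definition order_iso :: "nat list \<Rightarrow> nat list \<Rightarrow> bool" where
  "order_iso q s \<longleftrightarrow> length s = length q \<and>
     (\<forall>j<length q. \<forall>l<length q. q ! j < q ! l \<longleftrightarrow> s ! j < s ! l)"

lemma num_occurrences_eq_subseq_count:
  "num_occurrences q \<sigma> = subseq_count (order_iso q) \<sigma>"
proof -
  have "occurrences q \<sigma> = {ps. sorted_wrt (<) ps \<and> set ps \<subseteq> {..<length \<sigma>} \<and>
      order_iso q (map ((!) \<sigma>) ps)}"
    by (auto simp: occurrences_def order_iso_def)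
  then show ?thesis
    using card_positions_eq_subseq_count[of \<sigma> "order_iso q"] by (simp add: num_occurrences_def)
qed

lemma num_occurrences_short:
  assumes "length \<sigma> < length q"
  shows "num_occurrences q \<sigma> = 0"
  unfolding num_occurrences_eq_subseq_count subseq_count_eq_0_iff order_iso_def
  using assms list_emb_length by fastforce

lemma avoids_iff: "avoids \<sigma> q \<longleftrightarrow> (\<forall>l. subseq l \<sigma> \<longrightarrow> \<not> order_iso q l)"
  by (simp add: avoids_def num_occurrences_eq_subseq_count subseq_count_eq_0_iff)

section \<open>Patterns of length 2 and 3, and the effect of large initial entries on their
  counts\<close>

lemma length_eq_2_iff: "length s = Suc (Suc 0) \<longleftrightarrow> (\<exists>a b. s = [a, b])"
  by (auto simp: length_Suc_conv)

lemma length_eq_3_iff: "length s = Suc (Suc (Suc 0)) \<longleftrightarrow> (\<exists>a b c. s = [a, b, c])"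
  by (auto simp: length_Suc_conv)

text \<open>Stated as equations between functions, so that they can be unfolded inside
  \<open>subseq_count\<close>.\<close>

lemma order_iso_patterns:
  "order_iso [1,2] = (\<lambda>s. \<exists>a b. s = [a, b] \<and> a < b)"
  "order_iso [2,1] = (\<lambda>s. \<exists>a b. s = [a, b] \<and> b < a)"
  "order_iso [1,2,3] = (\<lambda>s. \<exists>a b c. s = [a, b, c] \<and> a < b \<and> b < c)"
  "order_iso [1,3,2] = (\<lambda>s. \<exists>a b c. s = [a, b, c] \<and> a < c \<and> c < b)"
  "order_iso [2,1,3] = (\<lambda>s. \<exists>a b c. s = [a, b, c] \<and> b < a \<and> a < c)"
  "order_iso [2,3,1] = (\<lambda>s. \<exists>a b c. s = [a, b, c] \<and> c < a \<and> a < b)"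
  "order_iso [3,1,2] = (\<lambda>s. \<exists>a b c. s = [a, b, c] \<and> b < c \<and> c < a)"
  "order_iso [3,2,1] = (\<lambda>s. \<exists>a b c. s = [a, b, c] \<and> c < b \<and> b < a)"
  by (auto simp: fun_eq_iff order_iso_def length_eq_2_iff length_eq_3_iff All_less_Suc)


text \<open>An occurrence that starts at the dominating entry \<open>m\<close> needs a pattern whose
  first letter is its largest. Deleting that letter leaves 12 from 312, 21 from 321, and any single
  entry from 21.\<close>

lemma subseq_count_order_iso_Cons:
  assumes "\<forall>y\<in>set xs. y < m"
  shows
    "subseq_count (\<lambda>l. order_iso [1,2] (m # l)) xs = 0"
    "subseq_count (\<lambda>l. order_iso [2,1] (m # l)) xs = length xs"
    "subseq_count (\<lambda>l. order_iso [1,2,3] (m # l)) xs = 0"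
    "subseq_count (\<lambda>l. order_iso [1,3,2] (m # l)) xs = 0"
    "subseq_count (\<lambda>l. order_iso [2,1,3] (m # l)) xs = 0"
    "subseq_count (\<lambda>l. order_iso [2,3,1] (m # l)) xs = 0"
    "subseq_count (\<lambda>l. order_iso [3,1,2] (m # l)) xs = num_occurrences [1,2] xs"
    "subseq_count (\<lambda>l. order_iso [3,2,1] (m # l)) xs = num_occurrences [2,1] xs"
  unfolding num_occurrences_eq_subseq_count order_iso_patterns
  \<comment> \<open>The right-hand sides are turned back into \<open>subseq_count\<close> terms, so
    that each clause becomes an equivalence of predicates.\<close>
  unfolding
    subseq_count_singleton[symmetric] subseq_count_False[of xs, symmetric]
  by (rule subseq_count_cong_set; auto dest!: bspec[OF assms])+

text \<open>Here both prefix entries are used. They form an ascent and any further entry is smaller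
  than both, so among the patterns of length 3 only 231 can occur, completed by an arbitrary entry
  of \<open>xs\<close>.\<close>

lemma subseq_count_order_iso_Cons_Cons:
  assumes "\<forall>y\<in>set xs. y < m" "m < M"
  shows
    "subseq_count (\<lambda>l. order_iso [1,2] (m # M # l)) xs = 1"
    "subseq_count (\<lambda>l. order_iso [2,1] (m # M # l)) xs = 0"
    "subseq_count (\<lambda>l. order_iso [1,2,3] (m # M # l)) xs = 0"
    "subseq_count (\<lambda>l. order_iso [1,3,2] (m # M # l)) xs = 0"
    "subseq_count (\<lambda>l. order_iso [2,1,3] (m # M # l)) xs = 0"
    "subseq_count (\<lambda>l. order_iso [2,3,1] (m # M # l)) xs = length xs"
    "subseq_count (\<lambda>l. order_iso [3,1,2] (m # M # l)) xs = 0"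
    "subseq_count (\<lambda>l. order_iso [3,2,1] (m # M # l)) xs = 0"
  unfolding order_iso_patterns
  unfolding subseq_count_empty[of xs, symmetric]
    subseq_count_singleton[symmetric] subseq_count_False[of xs, symmetric]
  using assms(2) by - (rule subseq_count_cong_set; auto dest!: bspec[OF assms(1)])+

text \<open>Clauses 3 to 5 show that the prefix creates no forbidden pattern; the others are the
  increments for the generating functions.\<close>

lemma num_occurrences_Cons_max:
  assumes "\<forall>y\<in>set xs. y < m"
  shows
    "num_occurrences [1,2] (m # xs) = num_occurrences [1,2] xs"
    "num_occurrences [2,1] (m # xs) = num_occurrences [2,1] xs + length xs"
    "num_occurrences [1,2,3] (m # xs) = num_occurrences [1,2,3] xs"
    "num_occurrences [1,3,2] (m # xs) = num_occurrences [1,3,2] xs"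
    "num_occurrences [2,1,3] (m # xs) = num_occurrences [2,1,3] xs"
    "num_occurrences [2,3,1] (m # xs) = num_occurrences [2,3,1] xs"
    "num_occurrences [3,1,2] (m # xs) = num_occurrences [3,1,2] xs + num_occurrences [1,2] xs"
    "num_occurrences [3,2,1] (m # xs) = num_occurrences [3,2,1] xs + num_occurrences [2,1] xs"
  unfolding num_occurrences_eq_subseq_count[of _ "m # xs"] subseq_count_Cons
  unfolding subseq_count_order_iso_Cons[OF assms] num_occurrences_eq_subseq_count[symmetric]
  by simp_all

lemma ball_less_trans:
  fixes m M :: "'a :: order"
  shows "\<forall>y\<in>A. y < m \<Longrightarrow> m < M \<Longrightarrow> \<forall>y\<in>A. y < M"
  using less_trans by blast

text \<open>The factors 2 arise because \<open>m\<close> and \<open>M\<close> can each alone play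
  the largest letter in front of \<open>xs\<close>. The summands 1 for 12 and
  \<open>length xs\<close> for 231 come from using both.\<close>

lemma num_occurrences_Cons_Cons_max:
  assumes "\<forall>y\<in>set xs. y < m" "m < M"
  shows
    "num_occurrences [1,2] (m # M # xs) = num_occurrences [1,2] xs + 1"
    "num_occurrences [2,1] (m # M # xs) = num_occurrences [2,1] xs + 2 * length xs"
    "num_occurrences [1,2,3] (m # M # xs) = num_occurrences [1,2,3] xs"
    "num_occurrences [1,3,2] (m # M # xs) = num_occurrences [1,3,2] xs"
    "num_occurrences [2,1,3] (m # M # xs) = num_occurrences [2,1,3] xs"
    "num_occurrences [2,3,1] (m # M # xs) = num_occurrences [2,3,1] xs + length xs"
    "num_occurrences [3,1,2] (m # M # xs) = num_occurrences [3,1,2] xs + 2 * num_occurrences [1,2] xs"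
    "num_occurrences [3,2,1] (m # M # xs) = num_occurrences [3,2,1] xs + 2 * num_occurrences [2,1] xs"
  unfolding num_occurrences_eq_subseq_count[of _ "m # M # xs"] subseq_count_Cons
  unfolding subseq_count_order_iso_Cons_Cons[OF assms] subseq_count_order_iso_Cons[OF assms(1)]
    subseq_count_order_iso_Cons[OF ball_less_trans[OF assms]]
    num_occurrences_eq_subseq_count[symmetric]
  by simp_all

section \<open>The structure of the avoiders\<close>

definition avoiders3 :: "nat \<Rightarrow> nat list set" where
  "avoiders3 n = avoiders n {[1,2,3], [1,3,2], [2,1,3]}"

lemma finite_avoiders3 [simp]: "finite (avoiders3 n)"
  unfolding avoiders3_def avoiders_def
  by (rule finite_subset[OF _ finite_permutations_of_set[of "{1..n}"]]) blast

lemma in_avoiders3_iff: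
  "\<sigma> \<in> avoiders3 n \<longleftrightarrow> set \<sigma> = {1..n} \<and> distinct \<sigma> \<and>
     (\<forall>q\<in>{[1,2,3], [1,3,2], [2,1,3]}. avoids \<sigma> q)"
  unfolding avoiders3_def avoiders_def permutations_of_set_def by blast

lemma avoiders3D:
  assumes "\<sigma> \<in> avoiders3 n"
  shows "set \<sigma> = {1..n}" "distinct \<sigma>"
  using assms by (simp_all add: in_avoiders3_iff)

lemma length_avoiders3: "\<sigma> \<in> avoiders3 n \<Longrightarrow> length \<sigma> = n"
  using avoiders3D[of \<sigma> n] distinct_card[of \<sigma>] by simp

lemma avoiders3_less_Suc: "\<sigma> \<in> avoiders3 n \<Longrightarrow> \<forall>y\<in>set \<sigma>. y < Suc n"
  using avoiders3D(1)[of \<sigma> n] by simp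

lemma avoiders3_0: "avoiders3 0 = {[]}"
proof -
  have "avoids [] q" if "q \<noteq> []" for q
    using that by (simp add: avoids_def num_occurrences_short)
  then have "[] \<in> avoiders3 0"
    unfolding in_avoiders3_iff by simp
  moreover have "\<sigma> = []" if "\<sigma> \<in> avoiders3 0" for \<sigma>
    using length_avoiders3[OF that] by simp
  ultimately show ?thesis by blast
qed

text \<open>Provides the case split for two entries whose relative position is unknown.\<close>

lemma subseq_pair:
  assumes "a \<in> set xs" "b \<in> set xs" "a \<noteq> b"
  shows "subseq [a, b] xs \<or> subseq [b, a] xs"
  using assms
proof (induction xs)
  case (Cons x xs)
  then show ?case
    by (auto simp: subseq_singleton_left)
qed simp

lemma Cons_max_in_avoiders3_iff:
  "Suc n # s \<in> avoiders3 (Suc n) \<longleftrightarrow> s \<in> avoiders3 n"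
proof -
  have "set (Suc n # s) = {1..Suc n} \<and> distinct (Suc n # s) \<longleftrightarrow>
      set s = {1..n} \<and> distinct s"
    by (auto simp: atLeastAtMostSuc_conv insert_ident)
  moreover have "(\<forall>q\<in>{[1,2,3], [1,3,2], [2,1,3]}. avoids (Suc n # s) q) \<longleftrightarrow>
      (\<forall>q\<in>{[1,2,3], [1,3,2], [2,1,3]}. avoids s q)" if "set s = {1..n}"
  proof -
    have "\<forall>y\<in>set s. y < Suc n"
      using that by simp
    then show ?thesis
      \<comment> \<open>\<open>One_nat_def\<close> is removed so that the letter 1 in the patterns
        is not rewritten and the clauses still match.\<close>
      using num_occurrences_Cons_max(3-5)[of s "Suc n"]
      by (simp add: avoids_def del: One_nat_def)
  qed
  ultimately show ?thesis
    unfolding in_avoiders3_iff by blast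
qed

lemma Cons_Cons_max_in_avoiders3_iff:
  "Suc n # Suc (Suc n) # s \<in> avoiders3 (Suc (Suc n)) \<longleftrightarrow> s \<in> avoiders3 n"
proof -
  have split: "{1..Suc (Suc n)} = insert (Suc n) (insert (Suc (Suc n)) {1..n})"
    by auto
  have "set (Suc n # Suc (Suc n) # s) = {1..Suc (Suc n)} \<and> distinct (Suc n # Suc (Suc n) # s) \<longleftrightarrow>
      set s = {1..n} \<and> distinct s"
    unfolding split by (auto simp: insert_ident)
  moreover have "(\<forall>q\<in>{[1,2,3], [1,3,2], [2,1,3]}. avoids (Suc n # Suc (Suc n) # s) q) \<longleftrightarrow>
      (\<forall>q\<in>{[1,2,3], [1,3,2], [2,1,3]}. avoids s q)" if "set s = {1..n}"
  proof -
    have "\<forall>y\<in>set s. y < Suc n"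
      using that by simp
    then show ?thesis
      using num_occurrences_Cons_Cons_max(3-5)[of s "Suc n" "Suc (Suc n)"]
      by (simp add: avoids_def del: One_nat_def)
  qed
  ultimately show ?thesis
    unfolding in_avoiders3_iff by blast
qed

text \<open>Treated separately because the prefix of two entries needs length at least 2.\<close>

lemma avoiders3_Suc_0: "avoiders3 (Suc 0) = (#) (Suc 0) ` avoiders3 0"
proof -
  have "\<sigma> = [Suc 0]" if \<sigma>: "\<sigma> \<in> avoiders3 (Suc 0)" for \<sigma>
  proof -
    obtain y where "\<sigma> = [y]"
      using length_avoiders3[OF \<sigma>] length_Suc_conv[of \<sigma> 0] by auto
    with avoiders3D(1)[OF \<sigma>] show ?thesis by simp
  qed
  moreover have "[Suc 0] \<in> avoiders3 (Suc 0)"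
    using Cons_max_in_avoiders3_iff[of 0 "[]"] by (simp add: avoiders3_0)
  ultimately have "avoiders3 (Suc 0) = {[Suc 0]}" by blast
  then show ?thesis by (simp add: avoiders3_0)
qed

text \<open>The three forbidden patterns force one of the two prefixes; the two preceding
  equivalences then show that the remainder is exactly an arbitrary avoider.\<close>

lemma avoiders3_Suc_Suc:
  "avoiders3 (Suc (Suc n)) = (#) (Suc (Suc n)) ` avoiders3 (Suc n) \<union>
     (\<lambda>s. Suc n # Suc (Suc n) # s) ` avoiders3 n"
proof -
  have "hd \<sigma> = Suc (Suc n) \<or> (\<exists>s. \<sigma> = Suc n # Suc (Suc n) # s)"
    if \<sigma>: "\<sigma> \<in> avoiders3 (Suc (Suc n))" for \<sigma>
  proof (rule disjCI)
    let ?N = "Suc (Suc n)"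
    assume ne: "\<nexists>s. \<sigma> = Suc n # ?N # s"
    obtain x y s where xys: "\<sigma> = x # y # s"
      using length_avoiders3[OF \<sigma>] by (auto simp: length_Suc_conv)
    have set: "set \<sigma> = {1..?N}" and dist: "distinct \<sigma>"
      using avoiders3D[OF \<sigma>] by simp_all
    have av: "\<not> (a < b \<and> b < c) \<and> \<not> (a < c \<and> c < b) \<and> \<not> (b < a \<and> a < c)"
      if "subseq [a, b, c] \<sigma>" for a b c
    proof -
      have "\<not> order_iso q [a, b, c]" if "q \<in> {[1,2,3], [1,3,2], [2,1,3]}" for q
        using \<sigma> \<open>subseq [a, b, c] \<sigma>\<close> that unfolding in_avoiders3_iff avoids_iff by blast
      from this[of "[1,2,3]"] this[of "[1,3,2]"] this[of "[2,1,3]"] show ?thesis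
        by (simp add: order_iso_patterns del: One_nat_def)
    qed
    have mem: "z \<in> set (x # y # s) \<longleftrightarrow> 1 \<le> z \<and> z \<le> ?N" for z
      using set xys by simp
    show "hd \<sigma> = ?N"
    proof (rule ccontr)
      assume "hd \<sigma> \<noteq> ?N"
      then have x: "x < ?N" "?N \<in> set (y # s)"
        using mem[of x] mem[of ?N] xys by auto
      \<comment> \<open>Otherwise the two largest entries both follow \<open>x\<close> and exceed
        it: in increasing order they complete a 123, in decreasing order a 132.\<close>
      have "x = Suc n"
      proof (rule ccontr)
        assume "x \<noteq> Suc n"
        then have "x < Suc n" "Suc n \<in> set (y # s)"
          using x mem[of "Suc n"] by auto
        with x subseq_pair[of "Suc n" "y # s" ?N]
        consider "subseq [x, Suc n, ?N] \<sigma>" | "subseq [x, ?N, Suc n] \<sigma>"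
          by (auto simp: xys)
        then show False
          by cases (use \<open>x < Suc n\<close> in \<open>auto dest!: av\<close>)
      qed
      then have "y \<noteq> ?N"
        using ne xys by auto
      \<comment> \<open>Being distinct from the two largest entries, \<open>y\<close> lies below
        \<open>x\<close>, and \<open>?N\<close> comes later still: a 213.\<close>
      then have "y < x" "subseq [x, y, ?N] \<sigma>"
        using \<open>x = Suc n\<close> x mem[of y] dist xys
        by (auto simp: subseq_singleton_left)
      then show False
        using av[of x y ?N] x by auto
    qed
  qed
  moreover have "\<sigma> \<noteq> []" if "\<sigma> \<in> avoiders3 (Suc (Suc n))" for \<sigma>
    using length_avoiders3[OF that] by auto
  ultimately have prefix: "\<exists>s. \<sigma> = Suc (Suc n) # s \<or> \<sigma> = Suc n # Suc (Suc n) # s"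
    if "\<sigma> \<in> avoiders3 (Suc (Suc n))" for \<sigma>
    using that by (metis list.collapse)
  show ?thesis
  proof (intro equalityI subsetI)
    fix \<sigma> assume \<sigma>: "\<sigma> \<in> avoiders3 (Suc (Suc n))"
    then obtain s where "\<sigma> = Suc (Suc n) # s \<or> \<sigma> = Suc n # Suc (Suc n) # s"
      using prefix by blast
    with \<sigma> show "\<sigma> \<in> (#) (Suc (Suc n)) ` avoiders3 (Suc n) \<union>
        (\<lambda>s. Suc n # Suc (Suc n) # s) ` avoiders3 n"
      using Cons_max_in_avoiders3_iff[of "Suc n" s] Cons_Cons_max_in_avoiders3_iff[of n s]
      by (elim disjE) simp_all
  next
    fix \<sigma> assume "\<sigma> \<in> (#) (Suc (Suc n)) ` avoiders3 (Suc n) \<union>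
        (\<lambda>s. Suc n # Suc (Suc n) # s) ` avoiders3 n"
    then show "\<sigma> \<in> avoiders3 (Suc (Suc n))"
      using Cons_max_in_avoiders3_iff[of "Suc n"] Cons_Cons_max_in_avoiders3_iff[of n]
      by (elim UnE imageE) simp_all
  qed
qed

section \<open>Generating functions\<close>

text \<open>The sum starts at n = 0, so the recursion over prefixes needs no correction for a
  truncated start.\<close>

definition weight_gf :: "(nat list \<Rightarrow> nat) \<Rightarrow> rat fps" where
  "weight_gf w = Abs_fps (\<lambda>n. of_nat (\<Sum>\<sigma>\<in>avoiders3 n. w \<sigma>))"

text \<open>Here \<open>g\<close> and \<open>h\<close> are the increments of \<open>w\<close> under
  the short and the long prefix. For n at least 2, the nth coefficient of \<open>weight_gf w\<close>
  is the sum of its two predecessors, of coefficient n - 1 for \<open>g\<close> and of coefficient n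
  - 2 for \<open>h\<close>; at n = 0 only \<open>w []\<close> remains, and at n = 1 only the short
  prefix exists.\<close>

lemma weight_gf_eq:
  assumes "\<And>n s. s \<in> avoiders3 n \<Longrightarrow> w (Suc n # s) = w s + g s"
    and "\<And>n s. s \<in> avoiders3 n \<Longrightarrow> w (Suc n # Suc (Suc n) # s) = w s + h s"
  shows "(1 - fps_X - fps_X ^ 2) * weight_gf w =
    of_nat (w []) + fps_X * weight_gf g + fps_X ^ 2 * weight_gf h"
proof (rule fps_ext)
  fix n
  have sum_Cons: "(\<Sum>\<sigma>\<in>(#) (Suc k) ` avoiders3 k. w \<sigma>) = (\<Sum>s\<in>avoiders3 k. w s + g s)" for k
    by (subst sum.reindex) (auto simp: assms)
  have sum_Cons_Cons: "(\<Sum>\<sigma>\<in>(\<lambda>s. Suc k # Suc (Suc k) # s) ` avoiders3 k. w \<sigma>) =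
      (\<Sum>s\<in>avoiders3 k. w s + h s)" for k
    by (subst sum.reindex) (auto simp: assms inj_on_def)
  \<comment> \<open>The two images are disjoint because their members have different first
    entries.\<close>
  have Suc_Suc: "(\<Sum>\<sigma>\<in>avoiders3 (Suc (Suc k)). w \<sigma>) =
      (\<Sum>s\<in>avoiders3 (Suc k). w s + g s) + (\<Sum>s\<in>avoiders3 k. w s + h s)" for k
    unfolding avoiders3_Suc_Suc sum_Cons[symmetric] sum_Cons_Cons[symmetric]
    by (rule sum.union_disjoint) auto
  consider "n = 0" | "n = Suc 0" | k where "n = Suc (Suc k)"
    by (metis not0_implies_Suc)
  then show "fps_nth ((1 - fps_X - fps_X ^ 2) * weight_gf w) n =
    fps_nth (of_nat (w []) + fps_X * weight_gf g + fps_X ^ 2 * weight_gf h) n"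
  proof cases
    case 1
    then show ?thesis
      by (simp add: weight_gf_def avoiders3_0)
  next
    case 2
    moreover have "w [Suc 0] = w [] + g []"
      using assms(1)[of "[]" 0] by (simp add: avoiders3_0)
    ultimately show ?thesis
      by (simp add: weight_gf_def algebra_simps fps_X_power_mult_nth avoiders3_Suc_0
          avoiders3_0 fps_of_nat[symmetric])
  next
    case 3
    then show ?thesis
      using arg_cong[OF Suc_Suc[of k], of rat_of_nat]
      by (simp add: weight_gf_def algebra_simps fps_X_power_mult_nth sum.distrib
          fps_of_nat[symmetric])
  qed
qed

lemma weight_gf_0: "weight_gf (\<lambda>_. 0) = 0"
  by (rule fps_ext) (simp add: weight_gf_def)

lemma weight_gf_double: "weight_gf (\<lambda>\<sigma>. 2 * w \<sigma>) = 2 * weight_gf w"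
  by (rule fps_ext) (simp add: weight_gf_def numeral_fps_const flip: sum_distrib_left)

text \<open>A permutation of length below 3 contains no pattern of length 3, so the cutoff in
  \<open>occurrence_gf\<close> discards only zeros.\<close>

lemma occurrence_gf_eq_weight_gf:
  assumes "length q = 3"
  shows "occurrence_gf q = weight_gf (num_occurrences q)"
proof (rule fps_ext)
  fix n
  show "fps_nth (occurrence_gf q) n = fps_nth (weight_gf (num_occurrences q)) n"
  proof (cases "n \<ge> 3")
    case True
    then show ?thesis
      unfolding occurrence_gf_def weight_gf_def total_occurrences_def avoiders3_def by simp
  next
    case False
    then have "num_occurrences q \<sigma> = 0" if "\<sigma> \<in> avoiders3 n" for \<sigma>
      using assms length_avoiders3[OF that] by (simp add: num_occurrences_short)
    then have "(\<Sum>\<sigma>\<in>avoiders3 n. num_occurrences q \<sigma>) = 0"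
      by (rule sum.neutral[OF ballI])
    with False show ?thesis
      by (simp add: occurrence_gf_def weight_gf_def)
  qed
qed

theorem theorem3p4:
  shows "occurrence_gf [2,3,1] = occurrence_gf [3,1,2] \<and>
    occurrence_gf [3,1,2] = fps_X ^ 3 * (1 + 2 * fps_X) / (1 - fps_X - fps_X ^ 2) ^ 3 \<and>
    occurrence_gf [3,2,1] =
      fps_X ^ 3 * (1 + 6 * fps_X + 12 * fps_X ^ 2 + 8 * fps_X ^ 3)
        / (1 - fps_X - fps_X ^ 2) ^ 4"
proof -
  define X D :: "rat fps" where "X = fps_X" and "D = 1 - X - X ^ 2"
  note one = num_occurrences_Cons_max[OF avoiders3_less_Suc]
  note two = num_occurrences_Cons_Cons_max[OF avoiders3_less_Suc lessI]
  note gf = weight_gf_eq[folded X_def, folded D_def]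
  define A where "A = weight_gf (\<lambda>_. 1)"
  define L where "L = weight_gf length"
  define w where "w q = weight_gf (num_occurrences q)" for q
  \<comment> \<open>\<open>A\<close> counts the avoiders. The constant weight has no increments, so
    only the empty permutation contributes on the right.\<close>
  have A: "D * A = 1"
    using gf[of "\<lambda>_. 1" "\<lambda>_. 0" "\<lambda>_. 0"] by (simp add: A_def weight_gf_0)
  have L: "D * L = X * A + X ^ 2 * (2 * A)"
    \<comment> \<open>The increment 2 is written \<open>2 * 1\<close> so that
      \<open>weight_gf_double\<close> applies.\<close>
    using gf[of length "\<lambda>_. 1" "\<lambda>_. 2 * 1"] unfolding L_def A_def weight_gf_double
    by simp
  have w12: "D * w [1,2] = X ^ 2 * A"
  proof -
    have "D * w [1,2] = of_nat (num_occurrences [1,2] []) +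
        X * weight_gf (\<lambda>_. 0) + X ^ 2 * weight_gf (\<lambda>_. 1)"
      \<comment> \<open>\<open>add_0_right\<close> matches the zero increment of the short prefix
        with the shape that \<open>gf\<close> requires.\<close>
      unfolding w_def by (rule gf) (simp_all only: one(1) two(1) add_0_right)
    then show ?thesis
      by (simp add: w_def A_def L_def weight_gf_0 weight_gf_double num_occurrences_short
          del: One_nat_def)
  qed
  have w21: "D * w [2,1] = X * L + X ^ 2 * (2 * L)"
  proof -
    have "D * w [2,1] = of_nat (num_occurrences [2,1] []) +
        X * weight_gf (length) + X ^ 2 * weight_gf (\<lambda>s. 2 * length s)"
      unfolding w_def by (rule gf) (simp_all only: one(2) two(2) add_0_right)
    then show ?thesis
      by (simp add: w_def A_def L_def weight_gf_0 weight_gf_double num_occurrences_short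
          del: One_nat_def)
  qed
  have w231: "D * w [2,3,1] = X ^ 2 * L"
  proof -
    have "D * w [2,3,1] = of_nat (num_occurrences [2,3,1] []) +
        X * weight_gf (\<lambda>_. 0) + X ^ 2 * weight_gf (length)"
      unfolding w_def by (rule gf) (simp_all only: one(6) two(6) add_0_right)
    then show ?thesis
      by (simp add: w_def A_def L_def weight_gf_0 weight_gf_double num_occurrences_short
          del: One_nat_def)
  qed
  have w312: "D * w [3,1,2] = X * w [1,2] + X ^ 2 * (2 * w [1,2])"
  proof -
    have "D * w [3,1,2] = of_nat (num_occurrences [3,1,2] []) +
        X * weight_gf (num_occurrences [1,2]) + X ^ 2 * weight_gf (\<lambda>s. 2 * num_occurrences [1,2] s)"
      unfolding w_def by (rule gf) (simp_all only: one(7) two(7) add_0_right)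
    then show ?thesis
      by (simp add: w_def A_def L_def weight_gf_0 weight_gf_double num_occurrences_short
          del: One_nat_def)
  qed
  have w321: "D * w [3,2,1] = X * w [2,1] + X ^ 2 * (2 * w [2,1])"
  proof -
    have "D * w [3,2,1] = of_nat (num_occurrences [3,2,1] []) +
        X * weight_gf (num_occurrences [2,1]) + X ^ 2 * weight_gf (\<lambda>s. 2 * num_occurrences [2,1] s)"
      unfolding w_def by (rule gf) (simp_all only: one(8) two(8) add_0_right)
    then show ?thesis
      by (simp add: w_def A_def L_def weight_gf_0 weight_gf_double num_occurrences_short
          del: One_nat_def)
  qed
  \<comment> \<open>With E = X + 2 X^2, the equations are D L = E A and D \<open>w [2,3,1]\<close> =
    X^2 L, while D \<open>w [1,2]\<close> = X^2 A and D \<open>w [3,1,2]\<close> = E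
    \<open>w [1,2]\<close>. The same factors enter in opposite order, whence the equality of the two
    series.\<close>
  have "w [2,3,1] * D ^ 3 = X ^ 3 * (1 + 2 * X)"
    using A L w231 by algebra
  moreover have "w [3,1,2] * D ^ 3 = X ^ 3 * (1 + 2 * X)"
    using A w12 w312 by algebra
  \<comment> \<open>The factor E enters three times, and E^3 = X^3 (1 + 2 X)^3 expands to the stated
    numerator.\<close>
  moreover have "w [3,2,1] * D ^ 4 = X ^ 3 * (1 + 6 * X + 12 * X ^ 2 + 8 * X ^ 3)"
    using A L w21 w321 by algebra
  \<comment> \<open>A zero \<open>D\<close> would contradict D A = 1; this permits cancelling the
    powers of \<open>D\<close>.\<close>
  moreover have "D \<noteq> 0"
    using A by auto
  ultimately have "w [2,3,1] = X ^ 3 * (1 + 2 * X) / D ^ 3"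
    "w [3,1,2] = X ^ 3 * (1 + 2 * X) / D ^ 3"
    "w [3,2,1] = X ^ 3 * (1 + 6 * X + 12 * X ^ 2 + 8 * X ^ 3) / D ^ 4"
    by (metis nonzero_mult_div_cancel_right power_not_zero)+
  then show ?thesis
    by (simp add: occurrence_gf_eq_weight_gf w_def X_def D_def)
qed

end
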